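(* Let $A$ be a complex algebra and let $(D_1, d_1)$ and $(D_2, d_2)$ be generalized derivations on $A$. If $(D_1D_2,\ d_1d_2)$ is a generalized derivation on $A$, then $d_1D_2$ and $d_2D_1$ map $A$ into $\mathrm{nil}(A)$.
   Context: Algebras are associative and not assumed to have an identity. $\mathrm{nil}(A)$ denotes the nilradical of $A$, i.e. the intersection of all prime ideals of $A$. A derivation on a ring (or algebra) $A$ is an additive mapping $d:A\to A$ with $d(xy)=d(x)y+xd(y)$ for all $x,y\in A$. A generalized derivation $(D,d)$ on $A$ is an additive mapping $D:A\to A$ together with a derivation $d$ on $A$ (the associated derivation) such that $D(xy)=D(x)y+xd(y)$ for all $x,y\in A$; in particular, saying that a pair $(D,d)$ is a generalized derivation includes that $d$ is a derivation. Products of maps denote composition: $D_1D_2(x)=D_1(D_2(x))$. *)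

theory Defs
  imports Complex_Main
begin

text \<open>The class \<open>ring\<close> has no unit, so algebras here are associative but not necessarily unital.\<close>

locale complex_algebra = vector_space scale
  for scale :: "complex \<Rightarrow> 'a::ring \<Rightarrow> 'a" (infixr "*C" 75) +
  assumes mult_scale_left: "(c *C x) * y = c *C (x * y)"
    and mult_scale_right: "x * (c *C y) = c *C (x * y)"
begin

definition two_sided_ideal :: "'a set \<Rightarrow> bool" where
  "two_sided_ideal I \<longleftrightarrow> subspace I \<and> (\<forall>x\<in>I. \<forall>a. a * x \<in> I \<and> x * a \<in> I)"

text \<open>Primeness in the noncommutative sense, \<open>I J \<subseteq> P \<Longrightarrow> I \<subseteq> P \<or> J \<subseteq> P\<close> for two-sided ideals.
  As \<open>P\<close> is closed under sums, \<open>I J \<subseteq> P\<close> need only be required of the products \<open>x * y\<close>.\<close>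

definition prime_ideal :: "'a set \<Rightarrow> bool" where
  "prime_ideal P \<longleftrightarrow> two_sided_ideal P \<and> P \<noteq> UNIV \<and>
     (\<forall>I J. two_sided_ideal I \<longrightarrow> two_sided_ideal J \<longrightarrow>
        (\<forall>x\<in>I. \<forall>y\<in>J. x * y \<in> P) \<longrightarrow> I \<subseteq> P \<or> J \<subseteq> P)"

text \<open>If there are no prime ideals, the intersection is the whole algebra.\<close>

definition nilradical :: "'a set" where
  "nilradical = \<Inter> {P. prime_ideal P}"

end

text \<open>Only additivity is required of the maps below, not complex linearity.\<close>

definition derivation :: "('a::ring \<Rightarrow> 'a) \<Rightarrow> bool" where
  "derivation d \<longleftrightarrow> additive d \<and> (\<forall>x y. d (x * y) = d x * y + x * d y)"

definition generalized_derivation :: "('a::ring \<Rightarrow> 'a) \<Rightarrow> ('a \<Rightarrow> 'a) \<Rightarrow> bool" where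
  "generalized_derivation D d \<longleftrightarrow>
     additive D \<and> derivation d \<and> (\<forall>x y. D (x * y) = D x * y + x * d y)"

end

theory Submission
  imports Defs
begin

text \<open>
  Every prime ideal contains a minimal one, and a minimal prime \<open>Q\<close> is invariant under every
  derivation \<open>d\<close>: the set of all \<open>x\<close> with \<open>d\<^sup>n x \<in> Q\<close> for all \<open>n\<close> is again prime, because the extreme
  term of the Leibniz formula has a nonzero integer coefficient. Comparing the two expressions for
  \<open>D\<^sub>1 (D\<^sub>2 (x * y))\<close> gives \<open>D\<^sub>2 x * d\<^sub>1 y + D\<^sub>1 x * d\<^sub>2 y = 0\<close>, and likewise
  \<open>d\<^sub>2 x * d\<^sub>1 y + d\<^sub>1 x * d\<^sub>2 y = 0\<close>. As in Posner's theorem the latter forces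
  \<open>d\<^sub>1\<close> or \<open>d\<^sub>2\<close> to map into \<open>Q\<close>. If, say, \<open>d\<^sub>1\<close> does but \<open>d\<^sub>2\<close> does not, then the former yields
  \<open>D\<^sub>1 x * z * d\<^sub>2 y \<in> Q\<close>, so \<open>D\<^sub>1\<close> maps into \<open>Q\<close>, and hence so does \<open>d\<^sub>2 \<circ> D\<^sub>1\<close>.
\<close>

section \<open>Relations forced by composing generalized derivations\<close>

lemma generalized_derivation_compD:
  assumes "generalized_derivation D\<^sub>1 d\<^sub>1" and "generalized_derivation D\<^sub>2 d\<^sub>2"
    and "generalized_derivation (D\<^sub>1 \<circ> D\<^sub>2) (d\<^sub>1 \<circ> d\<^sub>2)"
  shows "D\<^sub>2 x * d\<^sub>1 y + D\<^sub>1 x * d\<^sub>2 y = 0"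
proof -
  have add: "D\<^sub>1 (u + v) = D\<^sub>1 u + D\<^sub>1 v" for u v
    using assms(1) by (simp add: generalized_derivation_def additive_def)
  have m1: "D\<^sub>1 (u * v) = D\<^sub>1 u * v + u * d\<^sub>1 v" and m2: "D\<^sub>2 (u * v) = D\<^sub>2 u * v + u * d\<^sub>2 v"
    and m3: "D\<^sub>1 (D\<^sub>2 (u * v)) = D\<^sub>1 (D\<^sub>2 u) * v + u * d\<^sub>1 (d\<^sub>2 v)" for u v
    using assms by (simp_all add: generalized_derivation_def)
  have "D\<^sub>1 (D\<^sub>2 x) * y + u = D\<^sub>1 (D\<^sub>2 x) * y + v \<longleftrightarrow> u = v" for u v
    by simp
  moreover have "D\<^sub>1 (D\<^sub>2 x) * y + (D\<^sub>2 x * d\<^sub>1 y + D\<^sub>1 x * d\<^sub>2 y + x * d\<^sub>1 (d\<^sub>2 y))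
      = D\<^sub>1 (D\<^sub>2 x) * y + x * d\<^sub>1 (d\<^sub>2 y)"
    using m3[of x y] by (simp add: m1 m2 add algebra_simps)
  ultimately show ?thesis
    by simp
qed

lemma derivation_imp_generalized_derivation:
  "derivation d \<Longrightarrow> generalized_derivation d d"
  by (simp add: derivation_def generalized_derivation_def)

section \<open>Iterates of a derivation\<close>

context
  fixes d :: "'a::ring \<Rightarrow> 'a"
  assumes d: "derivation d"
begin

lemma derivation_add: "d (x + y) = d x + d y"
  using d by (simp add: derivation_def additive_def)

lemma derivation_mult: "d (x * y) = d x * y + x * d y"
  using d by (simp add: derivation_def)

lemma derivation_funpow_add: "(d ^^ n) (x + y) = (d ^^ n) x + (d ^^ n) y"
  by (induction n) (simp_all add: derivation_add)

lemma derivation_funpow_zero: "(d ^^ n) 0 = 0"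
  using derivation_funpow_add[of n 0 0] by simp

lemma derivation_funpow_Suc_mult:
  "(d ^^ Suc n) (x * y) = (d ^^ n) (d x * y) + (d ^^ n) (x * d y)"
  by (simp del: funpow.simps add: funpow_Suc_right derivation_mult derivation_funpow_add)

end

section \<open>Ideals and elementwise primeness\<close>

context complex_algebra
begin

context
  fixes I :: "'a set"
  assumes I: "two_sided_ideal I"
begin

lemma two_sided_ideal_subspace: "subspace I"
  using I by (simp add: two_sided_ideal_def)

lemma two_sided_ideal_mult_left: "x \<in> I \<Longrightarrow> a * x \<in> I"
  using I by (simp add: two_sided_ideal_def)

lemma two_sided_ideal_mult_right: "x \<in> I \<Longrightarrow> x * a \<in> I"
  using I by (simp add: two_sided_ideal_def)

lemmas two_sided_ideal_zero = subspace_0[OF two_sided_ideal_subspace]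
lemmas two_sided_ideal_add = subspace_add[OF two_sided_ideal_subspace]
lemmas two_sided_ideal_diff = subspace_diff[OF two_sided_ideal_subspace]
lemmas two_sided_ideal_scale = subspace_scale[OF two_sided_ideal_subspace]

lemma two_sided_ideal_scale_cancel:
  assumes "c *C x \<in> I" and "c \<noteq> 0"
  shows "x \<in> I"
  using two_sided_ideal_scale[OF assms(1), of "inverse c"] assms(2) by simp

end

lemma two_sided_idealI:
  assumes "0 \<in> I" and "\<And>x y. x \<in> I \<Longrightarrow> y \<in> I \<Longrightarrow> x + y \<in> I" and "\<And>c x. x \<in> I \<Longrightarrow> c *C x \<in> I"
    and "\<And>a x. x \<in> I \<Longrightarrow> a * x \<in> I" and "\<And>a x. x \<in> I \<Longrightarrow> x * a \<in> I"
  shows "two_sided_ideal I"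
  using assms by (simp add: two_sided_ideal_def subspace_def)

lemma prime_ideal_ideal: "prime_ideal P \<Longrightarrow> two_sided_ideal P"
  by (simp add: prime_ideal_def)

lemma prime_idealD:
  assumes "prime_ideal P" "two_sided_ideal I" "two_sided_ideal J"
    and "\<And>x y. x \<in> I \<Longrightarrow> y \<in> J \<Longrightarrow> x * y \<in> P"
  shows "I \<subseteq> P \<or> J \<subseteq> P"
  using assms by (simp add: prime_ideal_def)

text \<open>Primeness is about ideals, and without an identity the ideals generated by
  \<open>a\<close> and \<open>b\<close> are awkward to describe. Annihilators modulo
  \<open>P\<close> replace them: \<open>a\<close> lies in \<open>I\<close>, \<open>b\<close> in
  \<open>J\<close>, and \<open>I * K\<close> falls into \<open>P\<close>.\<close>

lemma prime_ideal_elementwise: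
  assumes P: "prime_ideal P" and ab: "\<And>x. a * x * b \<in> P"
  shows "a \<in> P \<or> b \<in> P"
proof -
  have PI: "two_sided_ideal P" and ne: "P \<noteq> UNIV"
    using P by (simp_all add: prime_ideal_def)
  note P_rules = two_sided_ideal_zero[OF PI] two_sided_ideal_add[OF PI] two_sided_ideal_scale[OF PI]
    two_sided_ideal_mult_left[OF PI] two_sided_ideal_mult_right[OF PI]
  define J where "J = {y. \<forall>x. a * x * y \<in> P}"
  define I where "I = {x. \<forall>y\<in>J. \<forall>z. x * z * y \<in> P}"
  define K where "K = {y. \<forall>x\<in>I. x * y \<in> P}"
  have JI: "two_sided_ideal J"
  proof (rule two_sided_idealI)
    show "w * x \<in> J" if "x \<in> J" for w x
      using that by (simp add: J_def) (metis mult.assoc)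
  qed (auto simp: J_def distrib_left mult_scale_right mult.assoc[symmetric] intro: P_rules)
  have II: "two_sided_ideal I"
  proof (rule two_sided_idealI)
    show "x * w \<in> I" if "x \<in> I" for w x
      using that by (simp add: I_def) (metis mult.assoc)
    show "w * x \<in> I" if "x \<in> I" for w x
      using that by (simp add: I_def mult.assoc P_rules)
  qed (auto simp: I_def distrib_right mult_scale_left intro: P_rules)
  have KI: "two_sided_ideal K"
  proof (rule two_sided_idealI)
    show "w * x \<in> K" if "x \<in> K" for w x
      using that two_sided_ideal_mult_right[OF II]
      by (simp add: K_def mult.assoc[symmetric])
  qed (auto simp: K_def distrib_left mult_scale_right mult.assoc[symmetric] intro: P_rules)
  have aI: "a \<in> I" and bJ: "b \<in> J"
    using ab by (simp_all add: I_def J_def)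
  have "I \<subseteq> P \<or> K \<subseteq> P"
    by (rule prime_idealD[OF P II KI]) (simp add: K_def)
  moreover have "J \<subseteq> P" if "K \<subseteq> P"
  proof -
    \<comment> \<open>All products \<open>x * y\<close> with \<open>y\<close> in \<open>J\<close>
      lie in \<open>K\<close>, hence in \<open>P\<close>. Primeness for the pair
      \<open>UNIV\<close>, \<open>J\<close> then makes up for the absent identity.\<close>
    have "UNIV \<subseteq> P \<or> J \<subseteq> P"
    proof (rule prime_idealD[OF P _ JI])
      show "two_sided_ideal UNIV"
        by (rule two_sided_idealI) simp_all
      show "x * y \<in> P" if "y \<in> J" for x y
        using that \<open>K \<subseteq> P\<close> by (auto simp: K_def I_def mult.assoc[symmetric])
    qed
    with ne show ?thesis by blast
  qed
  ultimately show ?thesis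
    using aI bJ by blast
qed

text \<open>The form in which primeness is verified below, for intersections of chains and for the
  largest part of a prime stable under a derivation.\<close>

lemma prime_idealI_elementwise:
  assumes PI: "two_sided_ideal P" and "P \<noteq> UNIV"
    and elem: "\<And>a b. (\<And>x. a * x * b \<in> P) \<Longrightarrow> a \<in> P \<or> b \<in> P"
  shows "prime_ideal P"
proof -
  have "I \<subseteq> P \<or> J \<subseteq> P"
    if "two_sided_ideal I" "two_sided_ideal J" "\<forall>x\<in>I. \<forall>y\<in>J. x * y \<in> P" for I J
  proof (rule ccontr)
    assume "\<not> (I \<subseteq> P \<or> J \<subseteq> P)"
    then obtain a b where "a \<in> I" "b \<in> J" "a \<notin> P" "b \<notin> P" by blast
    moreover from this have "a * x * b \<in> P" for x
      using that two_sided_ideal_mult_right by blast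
    ultimately show False using elem by blast
  qed
  with assms show ?thesis
    by (simp add: prime_ideal_def)
qed

section \<open>Minimal prime ideals\<close>

lemma prime_ideal_Inter_chain:
  assumes "C \<noteq> {}" and prime: "\<And>P. P \<in> C \<Longrightarrow> prime_ideal P"
    and chain: "\<And>P Q. P \<in> C \<Longrightarrow> Q \<in> C \<Longrightarrow> P \<subseteq> Q \<or> Q \<subseteq> P"
  shows "prime_ideal (\<Inter>C)"
proof (rule prime_idealI_elementwise)
  note I = prime_ideal_ideal[OF prime]
  show "two_sided_ideal (\<Inter>C)"
    by (rule two_sided_idealI)
      (auto intro: two_sided_ideal_zero[OF I] two_sided_ideal_add[OF I]
        two_sided_ideal_scale[OF I] two_sided_ideal_mult_left[OF I] two_sided_ideal_mult_right[OF I])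
  show "\<Inter>C \<noteq> UNIV"
    using assms(1) prime by (auto simp: prime_ideal_def)
  show "a \<in> \<Inter>C \<or> b \<in> \<Inter>C" if ab: "\<And>x. a * x * b \<in> \<Inter>C" for a b
  proof (rule ccontr)
    assume "\<not> ?thesis"
    then obtain P Q where PQ: "P \<in> C" "Q \<in> C" "a \<notin> P" "b \<notin> Q" by blast
    \<comment> \<open>The smaller of \<open>P\<close> and \<open>Q\<close> omits both
      elements.\<close>
    then obtain R where "R \<in> C" "a \<notin> R" "b \<notin> R"
      using chain[of P Q] by blast
    then show False
      using prime_ideal_elementwise[OF prime, of R a b] ab by blast
  qed
qed

lemma prime_ideal_contains_minimal:
  assumes "prime_ideal P"
  obtains Q where "prime_ideal Q" "Q \<subseteq> P" "\<And>R. prime_ideal R \<Longrightarrow> R \<subseteq> Q \<Longrightarrow> R = Q"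
proof -
  \<comment> \<open>Zorn's lemma provides maximal elements, so it is applied to the complements.\<close>
  define S where "S = {X. prime_ideal (- X) \<and> - X \<subseteq> P}"
  have "\<exists>M\<in>S. \<forall>X\<in>S. M \<subseteq> X \<longrightarrow> X = M"
  proof (rule subset_Zorn_nonempty)
    have "- P \<in> S" using assms by (simp add: S_def)
    then show "S \<noteq> {}" by blast
    fix C assume C: "C \<noteq> {}" "subset.chain S C"
    have "prime_ideal (\<Inter>(uminus ` C))"
    proof (rule prime_ideal_Inter_chain)
      show "uminus ` C \<noteq> {}" using C(1) by simp
      show "prime_ideal R" if "R \<in> uminus ` C" for R
        using that C(2) by (auto simp: S_def subset.chain_def)
      show "R \<subseteq> T \<or> T \<subseteq> R" if "R \<in> uminus ` C" "T \<in> uminus ` C" for R T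
        using that C(2) by (auto simp: subset_chain_def)
    qed
    moreover have "\<Inter>(uminus ` C) = - \<Union>C" by blast
    moreover have "- \<Union>C \<subseteq> P"
      using C by (fastforce simp: S_def subset.chain_def)
    ultimately show "\<Union>C \<in> S" by (simp add: S_def)
  qed
  then obtain M where M: "M \<in> S" "\<And>X. X \<in> S \<Longrightarrow> M \<subseteq> X \<Longrightarrow> X = M" by blast
  show thesis
  proof (rule that)
    show "prime_ideal (- M)" "- M \<subseteq> P" using M(1) by (simp_all add: S_def)
    show "R = - M" if "prime_ideal R" "R \<subseteq> - M" for R
      using M(2)[of "- R"] that \<open>- M \<subseteq> P\<close> by (auto simp: S_def)
  qed
qed

section \<open>The Leibniz formula modulo an ideal\<close>

text \<open>In each Leibniz term the orders add up to \<open>N < m + n\<close>, so the order on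
  \<open>x\<close> is below \<open>m\<close> or the order on \<open>y\<close> is below
  \<open>n\<close>.\<close>

lemma derivation_funpow_mult_in_ideal:
  assumes d: "derivation d" and P: "two_sided_ideal P"
    and "\<And>i. i < m \<Longrightarrow> (d ^^ i) x \<in> P" and "\<And>j. j < n \<Longrightarrow> (d ^^ j) y \<in> P" and "N < m + n"
  shows "(d ^^ N) (x * y) \<in> P"
  using assms(3-5)
proof (induction N arbitrary: x y m n)
  case 0
  then show ?case
    using two_sided_ideal_mult_left[OF P] two_sided_ideal_mult_right[OF P]
    by (cases "m = 0") fastforce+
next
  case (Suc N)
  have shift: "(d ^^ i) (d z) = (d ^^ Suc i) z" for i z
    by (simp add: funpow_swap1)
  have "(d ^^ N) (d x * y) \<in> P"
    \<comment> \<open>Truncated subtraction is harmless: if \<open>m = 0\<close>, the condition on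
      \<open>d x\<close> is vacuous and \<open>Suc N < n\<close> still gives
      \<open>N < n\<close>.\<close>
    by (rule Suc.IH[of "m - 1" _ n]) (use Suc.prems in \<open>auto simp del: funpow.simps simp: shift\<close>)
  moreover have "(d ^^ N) (x * d y) \<in> P"
    by (rule Suc.IH[of m _ "n - 1"]) (use Suc.prems in \<open>auto simp del: funpow.simps simp: shift\<close>)
  ultimately show ?case
    by (simp only: derivation_funpow_Suc_mult[OF d] two_sided_ideal_add[OF P])
qed

text \<open>The coefficient \<open>c\<close> below is the binomial coefficient \<open>m + n\<close> over \<open>m\<close>; only \<open>c > 0\<close> matters.\<close>

lemma derivation_funpow_mult_extreme_term:
  assumes d: "derivation d" and P: "two_sided_ideal P"
    and "\<And>i. i < m \<Longrightarrow> (d ^^ i) x \<in> P" and "\<And>j. j < n \<Longrightarrow> (d ^^ j) y \<in> P"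
  shows "\<exists>c>0. (d ^^ (m + n)) (x * y) - of_nat c *C ((d ^^ m) x * (d ^^ n) y) \<in> P"
  using assms(3,4)
proof (induction "m + n" arbitrary: m n x y)
  case 0
  then show ?case
    using two_sided_ideal_zero[OF P] by (intro exI[of _ 1]) simp
next
  case (Suc N)
  define t where "t = (d ^^ m) x * (d ^^ n) y"
  have shift: "(d ^^ i) (d z) = (d ^^ Suc i) z" for i z
    by (simp add: funpow_swap1)
  \<comment> \<open>As in Pascal's rule, the coefficient is a sum of two, one for each factor that
    receives the first derivative. A part is zero exactly when its index is zero; since
    \<open>m + n = Suc N\<close>, the sum is positive.\<close>
  have 1: "\<exists>c. (c > 0 \<longleftrightarrow> m > 0) \<and> (d ^^ N) (d x * y) - of_nat c *C t \<in> P"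
  proof (cases m)
    case 0
    have "(d ^^ N) (d x * y) \<in> P"
      by (rule derivation_funpow_mult_in_ideal[OF d P, of 0 _ n]) (use Suc 0 in auto)
    with 0 show ?thesis by (intro exI[of _ 0]) simp
  next
    case (Suc m')
    have "\<exists>c>0. (d ^^ (m' + n)) (d x * y) - of_nat c *C ((d ^^ m') (d x) * (d ^^ n) y) \<in> P"
      by (rule Suc.hyps(1)) (use Suc Suc.hyps(2) Suc.prems in \<open>auto simp del: funpow.simps simp: shift\<close>)
    with Suc Suc.hyps(2) show ?thesis
      by (simp del: funpow.simps add: t_def funpow_Suc_right)
  qed
  have 2: "\<exists>c. (c > 0 \<longleftrightarrow> n > 0) \<and> (d ^^ N) (x * d y) - of_nat c *C t \<in> P"
  proof (cases n)
    case 0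
    have "(d ^^ N) (x * d y) \<in> P"
      by (rule derivation_funpow_mult_in_ideal[OF d P, of m _ 0]) (use Suc 0 in auto)
    with 0 show ?thesis by (intro exI[of _ 0]) simp
  next
    case (Suc n')
    have "\<exists>c>0. (d ^^ (m + n')) (x * d y) - of_nat c *C ((d ^^ m) x * (d ^^ n') (d y)) \<in> P"
      by (rule Suc.hyps(1)) (use Suc Suc.hyps(2) Suc.prems in \<open>auto simp del: funpow.simps simp: shift\<close>)
    with Suc Suc.hyps(2) show ?thesis
      by (simp del: funpow.simps add: t_def funpow_Suc_right)
  qed
  from 1 2 obtain b c where
    bc: "b > 0 \<longleftrightarrow> m > 0" "c > 0 \<longleftrightarrow> n > 0"
    and mem: "(d ^^ N) (d x * y) - of_nat b *C t \<in> P" "(d ^^ N) (x * d y) - of_nat c *C t \<in> P"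
    by blast
  have "(d ^^ (m + n)) (x * y) - of_nat (b + c) *C t
      = ((d ^^ N) (d x * y) - of_nat b *C t) + ((d ^^ N) (x * d y) - of_nat c *C t)"
    using derivation_funpow_Suc_mult[OF d, of N x y] unfolding Suc.hyps(2)
    by (simp add: scale_left_distrib)
  also have "\<dots> \<in> P"
    by (rule two_sided_ideal_add[OF P mem])
  finally show ?case
    using bc Suc.hyps(2) unfolding t_def by (intro exI[of _ "b + c"]) auto
qed

lemma prime_ideal_derivation_core:
  assumes d: "derivation d" and P: "prime_ideal P"
  shows "prime_ideal {x. \<forall>n. (d ^^ n) x \<in> P}" (is "prime_ideal ?Q")
proof -
  note PI = prime_ideal_ideal[OF P]
  have elem: "a \<in> ?Q \<or> b \<in> ?Q" if ab: "\<And>x. a * x * b \<in> ?Q" for a b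
  proof (rule ccontr)
    assume "\<not> ?thesis"
    \<comment> \<open>Least orders at which the iterates leave \<open>P\<close>; the sandwich
      \<open>(d ^^ m) a * x * (d ^^ n) b\<close> will nevertheless lie in \<open>P\<close>, against
      primeness.\<close>
    then obtain m n where
      m: "(d ^^ m) a \<notin> P" "\<And>i. i < m \<Longrightarrow> (d ^^ i) a \<in> P" and
      n: "(d ^^ n) b \<notin> P" "\<And>i. i < n \<Longrightarrow> (d ^^ i) b \<in> P"
      using exists_least_iff[of "\<lambda>n. (d ^^ n) a \<notin> P"] exists_least_iff[of "\<lambda>n. (d ^^ n) b \<notin> P"]
      by auto
    have "(d ^^ m) a * x * (d ^^ n) b \<in> P" for x
    proof -
      have "(d ^^ j) (x * b) \<in> P" if "j < n" for j
        by (rule derivation_funpow_mult_in_ideal[OF d PI, of 0 _ n]) (use n that in auto)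
      then obtain c where c: "c > 0" and
        "(d ^^ (m + n)) (a * (x * b)) - of_nat c *C ((d ^^ m) a * (d ^^ n) (x * b)) \<in> P"
        using derivation_funpow_mult_extreme_term[OF d PI, of m a n "x * b"] m by blast
      moreover have "(d ^^ (m + n)) (a * (x * b)) \<in> P"
        using ab[of x] by (simp add: mult.assoc)
      ultimately have "of_nat c *C ((d ^^ m) a * (d ^^ n) (x * b)) \<in> P"
        using two_sided_ideal_diff[OF PI] by fastforce
      then have 1: "(d ^^ m) a * (d ^^ n) (x * b) \<in> P"
        by (rule two_sided_ideal_scale_cancel[OF PI]) (use c in simp)
      \<comment> \<open>A second use of the extreme term, with \<open>m = 0\<close>, isolates
        \<open>x * (d ^^ n) b\<close> inside \<open>(d ^^ n) (x * b)\<close>.\<close>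
      obtain c' where c': "c' > 0" and
        "(d ^^ n) (x * b) - of_nat c' *C (x * (d ^^ n) b) \<in> P"
        using derivation_funpow_mult_extreme_term[OF d PI, of 0 x n b] n by auto
      then have "(d ^^ m) a * ((d ^^ n) (x * b) - of_nat c' *C (x * (d ^^ n) b)) \<in> P"
        by (intro two_sided_ideal_mult_left[OF PI])
      from two_sided_ideal_diff[OF PI 1 this]
      have "of_nat c' *C ((d ^^ m) a * x * (d ^^ n) b) \<in> P"
        by (simp add: right_diff_distrib mult_scale_right mult.assoc)
      then show ?thesis
        by (rule two_sided_ideal_scale_cancel[OF PI]) (use c' in simp)
    qed
    then show False
      using prime_ideal_elementwise[OF P] m n by blast
  qed
  have right: "x * y \<in> ?Q" if "x \<in> ?Q" for x y
  proof -
    have "(d ^^ N) (x * y) \<in> P" for N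
      by (rule derivation_funpow_mult_in_ideal[OF d PI, of "Suc N" _ 0]) (use that in auto)
    then show ?thesis by simp
  qed
  have left: "y * x \<in> ?Q" if "x \<in> ?Q" for x y
  proof -
    have "(d ^^ N) (y * x) \<in> P" for N
      by (rule derivation_funpow_mult_in_ideal[OF d PI, of 0 _ "Suc N"]) (use that in auto)
    then show ?thesis by simp
  qed
  have ne: "?Q \<noteq> UNIV"
  proof
    assume "?Q = UNIV"
    then have "(d ^^ 0) x \<in> P" for x by blast
    with P show False by (auto simp: prime_ideal_def)
  qed
  have scale: "c *C x \<in> ?Q" if "x \<in> ?Q" for c x
    \<comment> \<open>As \<open>d\<close> is only additive, this needs primeness: \<open>(c *C x) * z * y = x * (c *C z) * y\<close>.\<close>
  proof -
    obtain y where "y \<notin> ?Q" using ne by blast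
    moreover have "(c *C x) * z * y \<in> ?Q" for z
    proof -
      have "(c *C x) * z * y = x * ((c *C z) * y)"
        by (simp add: mult_scale_left mult_scale_right mult.assoc)
      with right[OF that] show ?thesis by metis
    qed
    ultimately show ?thesis using elem by blast
  qed
  have "two_sided_ideal ?Q"
  proof (rule two_sided_idealI)
    show "0 \<in> ?Q"
      by (simp add: derivation_funpow_zero[OF d] two_sided_ideal_zero[OF PI])
    show "x + y \<in> ?Q" if "x \<in> ?Q" "y \<in> ?Q" for x y
      using that by (simp add: derivation_funpow_add[OF d] two_sided_ideal_add[OF PI])
  qed (fact scale left right)+
  then show ?thesis
    using ne elem by (rule prime_idealI_elementwise)
qed

text \<open>Minimality forces the prime \<open>?R\<close> to be all of \<open>Q\<close>; its
  condition for \<open>n = 1\<close> is the claim.\<close>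

lemma minimal_prime_ideal_derivation_invariant:
  assumes d: "derivation d" and Q: "prime_ideal Q"
    and minimal: "\<And>R. prime_ideal R \<Longrightarrow> R \<subseteq> Q \<Longrightarrow> R = Q" and "x \<in> Q"
  shows "d x \<in> Q"
proof -
  let ?R = "{x. \<forall>n. (d ^^ n) x \<in> Q}"
  have "?R \<subseteq> Q"
  proof
    fix z assume "z \<in> ?R"
    then have "(d ^^ 0) z \<in> Q" by blast
    then show "z \<in> Q" by simp
  qed
  then have "?R = Q"
    by (rule minimal[OF prime_ideal_derivation_core[OF d Q]])
  then have "(d ^^ 1) x \<in> Q"
    using \<open>x \<in> Q\<close> by blast
  then show ?thesis by simp
qed

section \<open>Posner-type arguments modulo a prime\<close>

text \<open>Modulo \<open>Q\<close>, exchanging \<open>a\<close> and \<open>b\<close> around any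
  middle factor changes the sign. Three exchanges turn \<open>a * z * a * u * b\<close> into its own
  negative, and 2 is invertible.\<close>

lemma prime_ideal_skew_pair:
  assumes Q: "prime_ideal Q" and skew: "\<And>z. b * z * a + a * z * b \<in> Q"
  shows "a \<in> Q \<or> b \<in> Q"
proof (rule ccontr)
  assume contra: "\<not> ?thesis"
  note QI = prime_ideal_ideal[OF Q]
  have "(a * z * a) * u * b \<in> Q" for z u
  proof -
    \<comment> \<open>One membership per exchange; first minus second plus third leaves twice the
      product.\<close>
    have "a * z * (b * u * a + a * u * b) \<in> Q" "(b * z * a + a * z * b) * (u * a) \<in> Q"
      "b * (z * a * u) * a + a * (z * a * u) * b \<in> Q"
      using two_sided_ideal_mult_left[OF QI] two_sided_ideal_mult_right[OF QI] skew by blast+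
    from two_sided_ideal_add[OF QI two_sided_ideal_diff[OF QI this(1,2)] this(3)]
    have "(a * z * a) * u * b + (a * z * a) * u * b \<in> Q"
      by (simp add: algebra_simps)
    then have "2 *C ((a * z * a) * u * b) \<in> Q"
      using scale_left_distrib[of 1 1] by simp
    then show ?thesis
      by (rule two_sided_ideal_scale_cancel[OF QI]) simp
  qed
  then have "a * z * a \<in> Q" for z
    using prime_ideal_elementwise[OF Q, of "a * z * a" b] contra by blast
  then show False
    using prime_ideal_elementwise[OF Q, of a a] contra by blast
qed

lemma prime_ideal_Posner:
  assumes d\<^sub>1: "derivation d\<^sub>1" and d\<^sub>2: "derivation d\<^sub>2" and Q: "prime_ideal Q"
    and rel: "\<And>x y. d\<^sub>2 x * d\<^sub>1 y + d\<^sub>1 x * d\<^sub>2 y = 0"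
  shows "range d\<^sub>1 \<subseteq> Q \<or> range d\<^sub>2 \<subseteq> Q"
proof -
  note QI = prime_ideal_ideal[OF Q]
  \<comment> \<open>Putting \<open>x * z\<close> for \<open>x\<close> in \<open>rel\<close> inserts
    a free middle factor, as elementwise primeness needs. For \<open>y = x\<close> this is a skew
    pair.\<close>
  have rel3: "d\<^sub>2 x * z * d\<^sub>1 y + d\<^sub>1 x * z * d\<^sub>2 y = 0" for x y z
  proof -
    have "d\<^sub>2 x * z * d\<^sub>1 y + d\<^sub>1 x * z * d\<^sub>2 y
        = (d\<^sub>2 (x * z) * d\<^sub>1 y + d\<^sub>1 (x * z) * d\<^sub>2 y) - x * (d\<^sub>2 z * d\<^sub>1 y + d\<^sub>1 z * d\<^sub>2 y)"
      unfolding derivation_mult[OF d\<^sub>1] derivation_mult[OF d\<^sub>2]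
      by (simp add: algebra_simps)
    then show ?thesis by (simp add: rel)
  qed
  have "d\<^sub>2 y \<in> Q" if x: "d\<^sub>1 x \<notin> Q" for x y
  proof -
    have "d\<^sub>2 x \<in> Q"
      using prime_ideal_skew_pair[OF Q, of "d\<^sub>2 x" "d\<^sub>1 x"] x
      by (simp add: rel3 two_sided_ideal_zero[OF QI])
    have "d\<^sub>1 x * z * d\<^sub>2 y \<in> Q" for z
    proof -
      have "d\<^sub>1 x * z * d\<^sub>2 y = 0 - d\<^sub>2 x * z * d\<^sub>1 y"
        using rel3[of x z y] by (simp add: eq_neg_iff_add_eq_0 add.commute)
      also have "\<dots> \<in> Q"
        by (intro two_sided_ideal_diff[OF QI] two_sided_ideal_zero[OF QI]
            two_sided_ideal_mult_right[OF QI] \<open>d\<^sub>2 x \<in> Q\<close>)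
      finally show ?thesis .
    qed
    then show ?thesis
      using prime_ideal_elementwise[OF Q] x by blast
  qed
  then show ?thesis by blast
qed

text \<open>Putting \<open>z * y\<close> for \<open>y\<close> in \<open>DQ\<close> gives
  \<open>D x * z * d y\<close> in \<open>Q\<close>. One value of \<open>d\<close> outside
  \<open>Q\<close> thus forces \<open>D x\<close> into \<open>Q\<close>, and invariance
  finishes.\<close>

lemma prime_ideal_range_comp:
  assumes d: "derivation d" and Q: "prime_ideal Q"
    and inv: "\<And>x. x \<in> Q \<Longrightarrow> d x \<in> Q" and DQ: "\<And>x y. D x * d y \<in> Q"
  shows "d (D x) \<in> Q"
proof (cases "range d \<subseteq> Q")
  case False
  then obtain y where y: "d y \<notin> Q" by blast
  note QI = prime_ideal_ideal[OF Q]
  have "D x * z * d y \<in> Q" for z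
  proof -
    have "D x * z * d y = D x * d (z * y) - D x * d z * y"
      by (simp add: derivation_mult[OF d] algebra_simps)
    also have "\<dots> \<in> Q"
      by (intro two_sided_ideal_diff[OF QI] two_sided_ideal_mult_right[OF QI] DQ)
    finally show ?thesis .
  qed
  then show ?thesis
    using prime_ideal_elementwise[OF Q] y inv by blast
qed auto

section \<open>Passage to the nilradical\<close>

lemma range_comp_subset_nilradical:
  assumes g1: "generalized_derivation D\<^sub>1 d\<^sub>1" and g2: "generalized_derivation D\<^sub>2 d\<^sub>2"
    and rel: "\<And>x y. d\<^sub>2 x * d\<^sub>1 y + d\<^sub>1 x * d\<^sub>2 y = 0"
    and Rel: "\<And>x y. D\<^sub>2 x * d\<^sub>1 y + D\<^sub>1 x * d\<^sub>2 y = 0"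
  shows "range (d\<^sub>1 \<circ> D\<^sub>2) \<subseteq> nilradical"
proof -
  have d1: "derivation d\<^sub>1" and d2: "derivation d\<^sub>2"
    using g1 g2 by (simp_all add: generalized_derivation_def)
  have "d\<^sub>1 (D\<^sub>2 x) \<in> P" if "prime_ideal P" for x P
  proof -
    from \<open>prime_ideal P\<close> obtain Q where Q: "prime_ideal Q" "Q \<subseteq> P"
      and minimal: "\<And>R. prime_ideal R \<Longrightarrow> R \<subseteq> Q \<Longrightarrow> R = Q"
      using prime_ideal_contains_minimal by blast
    note QI = prime_ideal_ideal[OF Q(1)]
    have "d\<^sub>1 (D\<^sub>2 x) \<in> Q"
    proof (cases "range d\<^sub>1 \<subseteq> Q")
      case False
      then have range: "range d\<^sub>2 \<subseteq> Q"
        using prime_ideal_Posner[OF d1 d2 Q(1) rel] by blast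
      show ?thesis
      proof (rule prime_ideal_range_comp[OF d1 Q(1), where D = D\<^sub>2])
        show "d\<^sub>1 y \<in> Q" if "y \<in> Q" for y
          using minimal_prime_ideal_derivation_invariant[OF d1 Q(1) minimal that] .
        show "D\<^sub>2 u * d\<^sub>1 v \<in> Q" for u v
        proof -
          \<comment> \<open>Since \<open>d\<^sub>2\<close> maps into \<open>Q\<close>, the other
            summand of \<open>Rel\<close> vanishes modulo \<open>Q\<close>.\<close>
          have "D\<^sub>2 u * d\<^sub>1 v = 0 - D\<^sub>1 u * d\<^sub>2 v"
            using Rel[of u v] by (simp add: eq_neg_iff_add_eq_0)
          also have "\<dots> \<in> Q"
            using range
            by (intro two_sided_ideal_diff[OF QI] two_sided_ideal_zero[OF QI]
                two_sided_ideal_mult_left[OF QI]) auto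
          finally show ?thesis .
        qed
      qed
    qed auto
    with Q(2) show ?thesis by blast
  qed
  then show ?thesis by (auto simp: nilradical_def)
qed

end

theorem corollary2p2:
  fixes scale :: "complex \<Rightarrow> 'a::ring \<Rightarrow> 'a"
    and D\<^sub>1 d\<^sub>1 D\<^sub>2 d\<^sub>2 :: "'a \<Rightarrow> 'a"
  assumes "complex_algebra scale"
    and "generalized_derivation D\<^sub>1 d\<^sub>1"
    and "generalized_derivation D\<^sub>2 d\<^sub>2"
    and "generalized_derivation (D\<^sub>1 \<circ> D\<^sub>2) (d\<^sub>1 \<circ> d\<^sub>2)"
  shows "range (d\<^sub>1 \<circ> D\<^sub>2) \<subseteq> complex_algebra.nilradical scale \<and>
         range (d\<^sub>2 \<circ> D\<^sub>1) \<subseteq> complex_algebra.nilradical scale"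
proof -
  interpret complex_algebra scale by fact
  have Rel: "D\<^sub>2 x * d\<^sub>1 y + D\<^sub>1 x * d\<^sub>2 y = 0" for x y
    using generalized_derivation_compD[OF assms(2-4)] .
  have "derivation d\<^sub>1" "derivation d\<^sub>2" "derivation (d\<^sub>1 \<circ> d\<^sub>2)"
    using assms(2-4) by (simp_all add: generalized_derivation_def)
  \<comment> \<open>A derivation is a generalized derivation associated with itself, so the same
    comparison applies to the associated maps.\<close>
  then have rel: "d\<^sub>2 x * d\<^sub>1 y + d\<^sub>1 x * d\<^sub>2 y = 0" for x y
    by (intro generalized_derivation_compD derivation_imp_generalized_derivation)
  \<comment> \<open>Both relations are symmetric in the indices up to the order of summands, so
    exchanging the indices yields the second inclusion.\<close>
  show ?thesis
    using range_comp_subset_nilradical[OF assms(2,3) rel Rel]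
      range_comp_subset_nilradical[OF assms(3,2), OF rel[unfolded add.commute[of "d\<^sub>2 _ * _"]]
        Rel[unfolded add.commute[of "D\<^sub>2 _ * _"]]]
    by blast
qed

end
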